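(* Every simple C*-algebra of type $II_1$ is finite, i.e. every projection in it is finite.
   Context: For a C*-algebra $A$ and $S\subseteq A$, $\mathrm{Ann}(S)=\{a\in A: as+sa=0 \ \forall s\in S\}$; the lattice of annihilators of $A$ is $\mathcal{P}=\{\mathrm{Ann}(\mathrm{Ann}(S)): S\subseteq A_+\}$ ordered by inclusion. $A$ is of type $II_1$ if $\mathcal{P}$ is a modular lattice. A projection $p$ is infinite if it is Murray–von Neumann equivalent in $A$ to a proper subprojection of itself, and finite otherwise; a simple C*-algebra is finite if every projection in it is finite. *)

theory Defs
  imports "HOL-Analysis.Analysis"
begin

text \<open>A C*-algebra is modelled on a type 'a that is a real Banach algebra
(associative, not necessarily unital, submultiplicative norm, complete),
together with a complex scalar multiplication extending the real one and an
involution satisfying the C*-identity.\<close>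

definition cstar_algebra ::
  "(complex \<Rightarrow> 'a::{real_normed_algebra,banach} \<Rightarrow> 'a) \<Rightarrow> ('a \<Rightarrow> 'a) \<Rightarrow> bool" where
  "cstar_algebra cmul star \<longleftrightarrow>
     (\<forall>c x y. cmul c (x + y) = cmul c x + cmul c y) \<and>
     (\<forall>c d x. cmul (c + d) x = cmul c x + cmul d x) \<and>
     (\<forall>c d x. cmul c (cmul d x) = cmul (c * d) x) \<and>
     (\<forall>x. cmul 1 x = x) \<and>
     (\<forall>r x. cmul (complex_of_real r) x = scaleR r x) \<and>
     (\<forall>c x. norm (cmul c x) = cmod c * norm x) \<and>
     (\<forall>c x y. cmul c (x * y) = cmul c x * y) \<and>
     (\<forall>c x y. cmul c (x * y) = x * cmul c y) \<and>
     (\<forall>x. star (star x) = x) \<and>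
     (\<forall>x y. star (x + y) = star x + star y) \<and>
     (\<forall>c x. star (cmul c x) = cmul (cnj c) (star x)) \<and>
     (\<forall>x y. star (x * y) = star y * star x) \<and>
     (\<forall>x. norm (star x * x) = (norm x)\<^sup>2)"

definition closed_ideal :: "(complex \<Rightarrow> 'a::real_normed_algebra \<Rightarrow> 'a) \<Rightarrow> 'a set \<Rightarrow> bool" where
  "closed_ideal cmul I \<longleftrightarrow>
     0 \<in> I \<and> (\<forall>x\<in>I. \<forall>y\<in>I. x + y \<in> I) \<and> (\<forall>c. \<forall>x\<in>I. cmul c x \<in> I) \<and>
     (\<forall>a. \<forall>x\<in>I. a * x \<in> I \<and> x * a \<in> I) \<and> closed I"

definition simple_cstar :: "(complex \<Rightarrow> 'a::real_normed_algebra \<Rightarrow> 'a) \<Rightarrow> bool" where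
  "simple_cstar cmul \<longleftrightarrow> (UNIV :: 'a set) \<noteq> {0} \<and>
     (\<forall>I. closed_ideal cmul I \<longrightarrow> I = {0} \<or> I = UNIV)"

definition positive :: "('a::ring \<Rightarrow> 'a) \<Rightarrow> 'a \<Rightarrow> bool" where
  "positive star a \<longleftrightarrow> (\<exists>x. a = star x * x)"

definition Ann :: "'a::ring set \<Rightarrow> 'a set" where
  "Ann S = {a. \<forall>s\<in>S. a * s + s * a = 0}"

definition ann_lattice :: "('a::ring \<Rightarrow> 'a) \<Rightarrow> 'a set set" where
  "ann_lattice star = {Ann (Ann S) | S. S \<subseteq> {a. positive star a}}"

definition is_join :: "'b set set \<Rightarrow> 'b set \<Rightarrow> 'b set \<Rightarrow> 'b set \<Rightarrow> bool" where
  "is_join P x y j \<longleftrightarrow> j \<in> P \<and> x \<subseteq> j \<and> y \<subseteq> j \<and> (\<forall>k\<in>P. x \<subseteq> k \<and> y \<subseteq> k \<longrightarrow> j \<subseteq> k)"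

definition is_meet :: "'b set set \<Rightarrow> 'b set \<Rightarrow> 'b set \<Rightarrow> 'b set \<Rightarrow> bool" where
  "is_meet P x y m \<longleftrightarrow> m \<in> P \<and> m \<subseteq> x \<and> m \<subseteq> y \<and> (\<forall>k\<in>P. k \<subseteq> x \<and> k \<subseteq> y \<longrightarrow> k \<subseteq> m)"

definition join_in :: "'b set set \<Rightarrow> 'b set \<Rightarrow> 'b set \<Rightarrow> 'b set" where
  "join_in P x y = (THE j. is_join P x y j)"

definition meet_in :: "'b set set \<Rightarrow> 'b set \<Rightarrow> 'b set \<Rightarrow> 'b set" where
  "meet_in P x y = (THE m. is_meet P x y m)"

definition modular_lattice :: "'b set set \<Rightarrow> bool" where
  "modular_lattice P \<longleftrightarrow>
     (\<forall>x\<in>P. \<forall>y\<in>P. (\<exists>j. is_join P x y j) \<and> (\<exists>m. is_meet P x y m)) \<and>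
     (\<forall>x\<in>P. \<forall>y\<in>P. \<forall>z\<in>P. x \<subseteq> z \<longrightarrow>
        join_in P x (meet_in P y z) = meet_in P (join_in P x y) z)"

definition type_II1 :: "('a::ring \<Rightarrow> 'a) \<Rightarrow> bool" where
  "type_II1 star \<longleftrightarrow> modular_lattice (ann_lattice star)"

definition projection :: "('a::ring \<Rightarrow> 'a) \<Rightarrow> 'a \<Rightarrow> bool" where
  "projection star p \<longleftrightarrow> p = star p \<and> p = p * p"

definition mvn_equiv :: "('a::ring \<Rightarrow> 'a) \<Rightarrow> 'a \<Rightarrow> 'a \<Rightarrow> bool" where
  "mvn_equiv star p q \<longleftrightarrow> (\<exists>v. star v * v = p \<and> v * star v = q)"

definition proper_subprojection :: "('a::ring \<Rightarrow> 'a) \<Rightarrow> 'a \<Rightarrow> 'a \<Rightarrow> bool" where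
  "proper_subprojection star q p \<longleftrightarrow> projection star q \<and> q = q * p \<and> q \<noteq> p"

definition infinite_projection :: "('a::ring \<Rightarrow> 'a) \<Rightarrow> 'a \<Rightarrow> bool" where
  "infinite_projection star p \<longleftrightarrow> projection star p \<and>
     (\<exists>q. proper_subprojection star q p \<and> mvn_equiv star p q)"

definition finite_projection :: "('a::ring \<Rightarrow> 'a) \<Rightarrow> 'a \<Rightarrow> bool" where
  "finite_projection star p \<longleftrightarrow> projection star p \<and> \<not> infinite_projection star p"

end

theory Submission
  imports Defs
begin

text \<open>
  If \<open>v\<close> implements an equivalence of \<open>p\<close> with a proper subprojection \<open>q\<close> and \<open>e = p - q\<close>, then the
  elements \<open>v\<^sup>n e\<close> behave like an orthonormal sequence of vectors with ``scalar'' \<open>e\<close>; relabel it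
  as \<open>f\<^sub>0, g\<^sub>0, f\<^sub>1, g\<^sub>1, \<dots>\<close>. Modularity fails as it does for closed subspaces of a Hilbert space:
  let \<open>X\<close>, \<open>Y\<close>, \<open>Z\<close> be generated by the \<open>f\<^sub>n - 2 f\<^sub>n\<^sub>+\<^sub>1\<close>, by the \<open>f\<^sub>n + 2\<^sup>-\<^sup>n g\<^sub>n\<close> and by the \<open>f\<^sub>n\<close>.
  Then \<open>X \<subseteq> Z\<close>, and \<open>X \<noteq> Z\<close> because the vector \<open>\<Sum> 2\<^sup>-\<^sup>n f\<^sub>n\<close> is orthogonal to \<open>X\<close>;
  \<open>Y\<close> meets \<open>Z\<close> trivially; and yet the join of \<open>X\<close> and \<open>Y\<close> contains \<open>Z\<close>, since an element \<open>a\<close> that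
  annihilates \<open>X\<close> and \<open>Y\<close> satisfies \<open>a g\<^sub>n = - a f\<^sub>0\<close> for all \<open>n\<close>, and comparing the norms of
  \<open>a (g\<^sub>0 + \<dots> + g\<^sub>N\<^sub>-\<^sub>1) = - N a f\<^sub>0\<close>, where the sum in brackets has norm \<open>\<surd>N\<close>, forces \<open>a f\<^sub>0 = 0\<close>.
\<close>

section \<open>Annihilators\<close>

lemma Ann_antimono: "S \<subseteq> T \<Longrightarrow> Ann T \<subseteq> Ann S"
  unfolding Ann_def by blast

lemma subset_Ann_iff:
  fixes S T :: "'a::ring set"
  shows "S \<subseteq> Ann T \<longleftrightarrow> T \<subseteq> Ann S"
proof -
  have "T \<subseteq> Ann S" if "S \<subseteq> Ann T" for S T :: "'a set"
  proof
    fix t assume "t \<in> T"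
    then have "s * t + t * s = 0" if "s \<in> S" for s
      using \<open>S \<subseteq> Ann T\<close> that unfolding Ann_def by blast
    then show "t \<in> Ann S"
      unfolding Ann_def by (simp add: add.commute)
  qed
  then show ?thesis
    by (intro iffI)
qed

lemma subset_Ann_Ann: "S \<subseteq> Ann (Ann S)"
  by (rule subset_Ann_iff[THEN iffD1, OF order_refl])

lemma Ann_Ann_Ann [simp]: "Ann (Ann (Ann S)) = Ann S"
  by (intro subset_antisym Ann_antimono subset_Ann_Ann)

section \<open>Joins, meets and the modular law\<close>

lemma is_join_unique: "is_join P x y j \<Longrightarrow> is_join P x y j' \<Longrightarrow> j = j'"
  unfolding is_join_def by (intro subset_antisym) simp_all

lemma is_meet_unique: "is_meet P x y m \<Longrightarrow> is_meet P x y m' \<Longrightarrow> m = m'"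
  unfolding is_meet_def by (intro subset_antisym) simp_all

lemma join_in_eq: "is_join P x y j \<Longrightarrow> join_in P x y = j"
  unfolding join_in_def by (metis is_join_unique the_equality)

lemma meet_in_eq: "is_meet P x y m \<Longrightarrow> meet_in P x y = m"
  unfolding meet_in_def by (metis is_meet_unique the_equality)

lemma zero_in_ann_lattice: "x \<in> ann_lattice star \<Longrightarrow> 0 \<in> x"
  unfolding ann_lattice_def by (clarify, simp add: Ann_def)

text \<open>The modular law for \<open>x \<subseteq> z\<close> collapses: its left side is
  \<open>x\<close> because the meet of \<open>y\<close> and \<open>z\<close> is \<open>{0}\<close>.
  Its right side is \<open>z\<close>: the join is some \<open>Ann (Ann S)\<close>, and
  \<open>Ann S\<close> lies in \<open>Ann x\<close> and \<open>Ann y\<close>, hence in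
  \<open>Ann z\<close>, so \<open>z\<close> lies in the join.\<close>

lemma modular_ann_lattice_cancel:
  fixes star :: "'a::ring \<Rightarrow> 'a"
  assumes mod: "modular_lattice (ann_lattice star)"
    and x: "x \<in> ann_lattice star" and y: "y \<in> ann_lattice star" and z: "z \<in> ann_lattice star"
    and xz: "x \<subseteq> z" and yz: "y \<inter> z = {0}" and xyz: "Ann x \<inter> Ann y \<subseteq> Ann z"
  shows "x = z"
proof -
  let ?P = "ann_lattice star"
  obtain m where m: "is_meet ?P y z m"
    using mod y z unfolding modular_lattice_def by blast
  obtain j where j: "is_join ?P x y j"
    using mod x y unfolding modular_lattice_def by blast
  have "m \<in> ?P" "m \<subseteq> y \<inter> z"
    using m by (simp_all add: is_meet_def)
  then have m0: "m = {0}"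
    using zero_in_ann_lattice[of m star] unfolding yz by auto
  have xm: "is_join ?P x m x"
    unfolding is_join_def m0 using x zero_in_ann_lattice[OF x] by blast
  have jz: "is_meet ?P j z z"
  proof -
    obtain S where S: "j = Ann (Ann S)"
      using j unfolding is_join_def ann_lattice_def by blast
    have "Ann S \<subseteq> Ann x \<inter> Ann y"
      using j unfolding S is_join_def by (simp add: subset_Ann_iff[of "Ann S"])
    then have "Ann S \<subseteq> Ann z"
      using xyz by (rule subset_trans)
    then have "z \<subseteq> j"
      unfolding S by (rule subset_Ann_iff[THEN iffD1])
    then show ?thesis
      using z unfolding is_meet_def by blast
  qed
  have "join_in ?P x (meet_in ?P y z) = meet_in ?P (join_in ?P x y) z"
    using mod x y z xz unfolding modular_lattice_def by blast
  then show ?thesis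
    by (simp add: meet_in_eq[OF m] join_in_eq[OF j] join_in_eq[OF xm] meet_in_eq[OF jz])
qed

section \<open>C*-identities over the reals\<close>

locale cstar_ring =
  fixes star :: "'a::{real_normed_algebra,banach} \<Rightarrow> 'a"
  assumes star_star [simp]: "star (star x) = x"
    and star_add: "star (x + y) = star x + star y"
    and star_scaleR: "star (r *\<^sub>R x) = r *\<^sub>R star x"
    and star_mult: "star (x * y) = star y * star x"
    and norm_star_mult_self: "norm (star x * x) = (norm x)\<^sup>2"
begin

lemma star_zero [simp]: "star 0 = 0"
  using star_scaleR[of 0 0] by simp

lemma star_minus: "star (- x) = - star x"
  using star_scaleR[of "-1" x] by simp

lemma star_diff: "star (x - y) = star x - star y"
  using star_add[of x "- y"] star_minus by simp

lemma star_sum: "star (sum f A) = (\<Sum>i\<in>A. star (f i))"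
  by (induction A rule: infinite_finite_induct) (auto simp: star_add)

lemma star_mult_self_eq_0_iff [simp]: "star x * x = 0 \<longleftrightarrow> x = 0"
  using norm_star_mult_self[of x] by auto

lemma positive_mult_star: "positive star (x * star x)"
  unfolding positive_def by (metis star_star)

text \<open>Moving \<open>a * star a\<close> past the sign turns the square of the self-adjoint
  \<open>star a * a\<close> into a multiple of \<open>a * a\<close>; the C*-identity, used twice,
  then gives \<open>a = 0\<close>.\<close>

lemma eq_0_if_star_anticommutes:
  assumes "a * a = 0" and "a * star a + star a * a = 0"
  shows "a = 0"
proof -
  have eq: "a * star a = - (star a * a)"
    using assms(2) by (simp add: eq_neg_iff_add_eq_0)
  have "star (star a * a) * (star a * a) = star a * (a * star a) * a"
    by (simp add: star_mult mult.assoc)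
  also have "\<dots> = 0"
    unfolding eq using assms(1) by (simp add: mult.assoc)
  finally show ?thesis
    by simp
qed

end

section \<open>Orthonormal sequences\<close>

locale orthonormal_sequence = cstar_ring star
  for star :: "'a::{real_normed_algebra,banach} \<Rightarrow> 'a" +
  fixes e :: 'a and u :: "nat \<Rightarrow> 'a"
  assumes orthonormal: "star (u i) * u j = (if i = j then e else 0)"
    and u_e: "u i * e = u i"
    and e_nonzero: "e \<noteq> 0"
begin

lemma star_e: "star e = e"
  using star_mult[of "star (u 0)" "u 0"] orthonormal[of 0 0] by simp

lemma e_idem: "e * e = e"
  using orthonormal[of 0 0] u_e[of 0] by (metis mult.assoc)

text \<open>With \<open>star \<xi> * \<eta>\<close> read as an inner product whose scalars are
  multiples of \<open>e\<close>, these are the nonzero vectors.\<close>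

definition vec :: "'a \<Rightarrow> bool" where
  "vec \<xi> \<longleftrightarrow> \<xi> * e = \<xi> \<and> (\<exists>r::real. r \<noteq> 0 \<and> star \<xi> * \<xi> = r *\<^sub>R e)"

definition rank_one :: "'a set \<Rightarrow> 'a set" where
  "rank_one X = (\<lambda>\<xi>. \<xi> * star \<xi>) ` X"

lemma vec_u: "vec (u i)"
  unfolding vec_def using u_e orthonormal[of i i] by (intro conjI exI[of _ 1]) auto

lemma vec_combination:
  assumes "i \<noteq> j" "r \<noteq> 0"
  shows "vec (r *\<^sub>R u i + s *\<^sub>R u j)"
proof -
  have "star (r *\<^sub>R u i + s *\<^sub>R u j) * (r *\<^sub>R u i + s *\<^sub>R u j) = (r\<^sup>2 + s\<^sup>2) *\<^sub>R e"
    using assms by (simp add: star_add star_scaleR distrib_left distrib_right orthonormal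
        power2_eq_square scaleR_add_left)
  moreover have "r\<^sup>2 + s\<^sup>2 \<noteq> 0"
    using assms by (simp add: sum_power2_eq_zero_iff)
  ultimately show ?thesis
    unfolding vec_def by (metis distrib_right mult_scaleR_left u_e)
qed

text \<open>\<open>\<xi> \<xi>\<^sup>*\<close> is a nonzero multiple of an idempotent, so anticommuting with it means annihilating
  it on both sides.\<close>

lemma anticommute_rank_one_iff:
  assumes "vec \<xi>"
  shows "a * (\<xi> * star \<xi>) + \<xi> * star \<xi> * a = 0 \<longleftrightarrow> a * \<xi> = 0 \<and> star \<xi> * a = 0"
proof
  assume anti: "a * (\<xi> * star \<xi>) + \<xi> * star \<xi> * a = 0"
  obtain r where r: "r \<noteq> 0" "star \<xi> * \<xi> = r *\<^sub>R e" and \<xi>e: "\<xi> * e = \<xi>"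
    using assms unfolding vec_def by blast
  have e\<xi>: "e * star \<xi> = star \<xi>"
    using \<xi>e by (metis star_e star_mult)
  define q where "q = \<xi> * star \<xi>"
  have "q * q = \<xi> * (star \<xi> * \<xi>) * star \<xi>"
    by (simp add: q_def mult.assoc)
  then have qq: "q * q = r *\<^sub>R q"
    by (simp add: r \<xi>e q_def)
  have eq: "a * q = - (q * a)"
    using anti by (simp add: q_def eq_neg_iff_add_eq_0)
  \<comment> \<open>Evaluating \<open>q * a * q\<close> in two ways shows that \<open>a\<close> also
    commutes with \<open>q\<close>.\<close>
  have "q * (a * q) = - (r *\<^sub>R (q * a))"
    using qq by (simp add: eq mult.assoc[symmetric])
  moreover have "(q * a) * q = - (r *\<^sub>R (a * q))"
  proof -
    have "q * a = - (a * q)"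
      using eq by simp
    then show ?thesis
      by (metis minus_mult_left mult.assoc mult_scaleR_right qq)
  qed
  ultimately have "r *\<^sub>R (a * q) = r *\<^sub>R (q * a)"
    by (auto simp: mult.assoc)
  then have comm: "a * q = q * a"
    using r by simp
  then have "2 *\<^sub>R (a * q) = 0"
    using eq by (metis add.right_inverse scaleR_2)
  then have aq: "a * q = 0" and qa: "q * a = 0"
    using comm by auto
  have "a * q * \<xi> = r *\<^sub>R (a * \<xi>)"
    using r \<xi>e by (simp add: q_def mult.assoc)
  moreover have "star \<xi> * (q * a) = r *\<^sub>R (star \<xi> * a)"
    using r e\<xi> by (metis (no_types) mult.assoc mult_scaleR_left q_def)
  ultimately show "a * \<xi> = 0 \<and> star \<xi> * a = 0"
    using aq qa r by simp
next
  assume "a * \<xi> = 0 \<and> star \<xi> * a = 0"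
  then show "a * (\<xi> * star \<xi>) + \<xi> * star \<xi> * a = 0"
    by (simp add: mult.assoc[symmetric]) (simp add: mult.assoc)
qed

lemma Ann_rank_one_iff:
  assumes "\<And>\<xi>. \<xi> \<in> X \<Longrightarrow> vec \<xi>"
  shows "a \<in> Ann (rank_one X) \<longleftrightarrow> (\<forall>\<xi>\<in>X. a * \<xi> = 0 \<and> star \<xi> * a = 0)"
proof -
  have "a \<in> Ann (rank_one X) \<longleftrightarrow> (\<forall>\<xi>\<in>X. a * (\<xi> * star \<xi>) + \<xi> * star \<xi> * a = 0)"
    unfolding Ann_def rank_one_def by blast
  also have "\<dots> \<longleftrightarrow> (\<forall>\<xi>\<in>X. a * \<xi> = 0 \<and> star \<xi> * a = 0)"
    by (rule ball_cong[OF refl]) (rule anticommute_rank_one_iff[OF assms])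
  finally show ?thesis .
qed

lemma rank_one_in_Ann:
  assumes "\<And>\<xi>. \<xi> \<in> X \<Longrightarrow> vec \<xi>" and "\<And>\<xi>. \<xi> \<in> X \<Longrightarrow> star \<xi> * \<eta> = 0"
  shows "\<eta> * star \<eta> \<in> Ann (rank_one X)"
proof -
  have "star \<eta> * \<xi> = 0" if "\<xi> \<in> X" for \<xi>
    using assms(2)[OF that] by (metis star_mult star_star star_zero)
  then show ?thesis
    using assms by (simp add: Ann_rank_one_iff mult.assoc) (simp add: mult.assoc[symmetric])
qed

text \<open>Orthogonality to \<open>X\<close> puts \<open>\<eta> * star \<eta>\<close> into
  \<open>Ann (rank_one X)\<close>, so \<open>a\<close> anticommutes with it.\<close>

lemma kills_vec_if_Ann_Ann:
  assumes "\<And>\<xi>. \<xi> \<in> X \<Longrightarrow> vec \<xi>" and "\<And>\<xi>. \<xi> \<in> X \<Longrightarrow> star \<xi> * \<eta> = 0"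
    and "vec \<eta>" and "a \<in> Ann (Ann (rank_one X))"
  shows "a * \<eta> = 0" "star \<eta> * a = 0"
proof -
  have "a * (\<eta> * star \<eta>) + \<eta> * star \<eta> * a = 0"
    using rank_one_in_Ann[of X \<eta>] assms by (auto simp: Ann_def)
  then show "a * \<eta> = 0" "star \<eta> * a = 0"
    using anticommute_rank_one_iff[OF assms(3)] by blast+
qed

text \<open>The two conditions describing \<open>Ann (rank_one X)\<close> are swapped by
  \<open>star\<close>, so this set contains \<open>star a\<close> along with \<open>a\<close>, and
  \<open>a\<close> anticommutes with both.\<close>

lemma Ann_Int_Ann_Ann:
  assumes X: "\<And>\<xi>. \<xi> \<in> X \<Longrightarrow> vec \<xi>"
    and a: "a \<in> Ann (rank_one X)" "a \<in> Ann (Ann (rank_one X))"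
  shows "a = 0"
proof (rule eq_0_if_star_anticommutes)
  have iff: "b \<in> Ann (rank_one X) \<longleftrightarrow> (\<forall>\<xi>\<in>X. b * \<xi> = 0 \<and> star \<xi> * b = 0)" for b
    by (rule Ann_rank_one_iff) (rule X)
  have "star a \<in> Ann (rank_one X)"
    using a(1) unfolding iff by (metis star_mult star_star star_zero)
  then show "a * star a + star a * a = 0"
    using a(2) by (auto simp: Ann_def)
  have "2 *\<^sub>R (a * a) = 0"
    using a unfolding Ann_def by (simp add: scaleR_2)
  then show "a * a = 0"
    by simp
qed

lemma rank_one_in_ann_lattice: "Ann (Ann (rank_one X)) \<in> ann_lattice star"
  unfolding ann_lattice_def rank_one_def using positive_mult_star by auto

lemma norm_e: "norm e = 1"
  using norm_star_mult_self[of e] e_nonzero by (simp add: star_e e_idem power2_eq_square)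

lemma norm_u: "norm (u i) = 1"
  using norm_star_mult_self[of "u i"] by (simp add: orthonormal norm_e abs_square_eq_1)

lemma norm_sum_u:
  assumes "inj s"
  shows "norm (\<Sum>n<N. u (s n)) = sqrt (real N)"
proof -
  have "star (\<Sum>n<N. u (s n)) * (\<Sum>n<N. u (s n)) = (\<Sum>n<N. \<Sum>m<N. if n = m then e else 0)"
    using assms by (simp add: star_sum sum_product orthonormal inj_eq)
  also have "\<dots> = real N *\<^sub>R e"
    by (simp add: sum_constant_scaleR)
  finally have "(norm (\<Sum>n<N. u (s n)))\<^sup>2 = real N"
    by (metis norm_star_mult_self norm_scaleR norm_e mult_1_right abs_of_nat)
  then show ?thesis
    by (metis norm_ge_zero real_sqrt_unique)
qed

text \<open>The \<open>b u (s n)\<close> are Fourier coefficients of \<open>b\<^sup>*\<close>, so their partial sums grow at most like \<open>\<surd>N\<close>.\<close>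

lemma constant_coefficients_eq_0:
  fixes s :: "nat \<Rightarrow> nat"
  assumes "inj s" and const: "\<And>n. b * u (s n) = c"
  shows "c = 0"
proof (rule ccontr)
  assume "c \<noteq> 0"
  then obtain N :: nat where N: "(norm b / norm c)\<^sup>2 < real N"
    using reals_Archimedean2 by blast
  have "real N * norm c = norm (b * (\<Sum>n<N. u (s n)))"
    by (simp add: sum_distrib_left const sum_constant_scaleR)
  also have "\<dots> \<le> norm b * sqrt (real N)"
    using norm_mult_ineq norm_sum_u[OF assms(1)] by metis
  finally have "sqrt (real N) * (sqrt (real N) * norm c) \<le> sqrt (real N) * norm b"
    by (metis mult.assoc mult.commute of_nat_0_le_iff real_sqrt_mult_self abs_of_nat)
  moreover have "sqrt (real N) > 0"
    using N by (cases N) (auto simp: not_less)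
  ultimately have "sqrt (real N) * norm c \<le> norm b"
    by (metis mult_le_cancel_left_pos)
  then have "sqrt (real N) \<le> norm b / norm c"
    using \<open>c \<noteq> 0\<close> by (simp add: field_simps)
  then have "real N \<le> (norm b / norm c)\<^sup>2"
    by (metis real_sqrt_ge_zero of_nat_0_le_iff power_mono real_sqrt_pow2)
  with N show False
    by simp
qed

section \<open>Three families of vectors that violate modularity\<close>

definition f :: "nat \<Rightarrow> 'a" where "f n = u (2 * n)"

definition g :: "nat \<Rightarrow> 'a" where "g n = u (2 * n + 1)"

definition X :: "'a set" where "X = range (\<lambda>n. f n - 2 *\<^sub>R f (Suc n))"

definition Y :: "'a set" where "Y = range (\<lambda>n. f n + (1/2)^n *\<^sub>R g n)"

definition Z :: "'a set" where "Z = range f"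

lemma inner_f_g [simp]:
  "star (f i) * f j = (if i = j then e else 0)"
  "star (g i) * g j = (if i = j then e else 0)"
  "star (f i) * g j = 0"
  "star (g i) * f j = 0"
proof -
  have "2 * i \<noteq> Suc (2 * j)" "Suc (2 * i) \<noteq> 2 * j"
    by presburger+
  then show "star (f i) * g j = 0" "star (g i) * f j = 0"
    by (simp_all add: f_def g_def orthonormal)
qed (simp_all add: f_def g_def orthonormal)

lemma vec_X: "\<xi> \<in> X \<Longrightarrow> vec \<xi>"
  using vec_combination[of "2 * n" "2 * Suc n" 1 "-2" for n] by (auto simp: X_def f_def)

lemma vec_Y: "\<xi> \<in> Y \<Longrightarrow> vec \<xi>"
  using vec_combination[of "2 * n" "2 * n + 1" 1 "(1/2)^n" for n] by (auto simp: Y_def f_def g_def)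

lemma vec_Z: "\<xi> \<in> Z \<Longrightarrow> vec \<xi>"
  using vec_u by (auto simp: Z_def f_def)

lemma Ann_Z_iff: "a \<in> Ann (rank_one Z) \<longleftrightarrow> (\<forall>n. a * f n = 0 \<and> star (f n) * a = 0)"
  by (subst Ann_rank_one_iff) (auto intro: vec_Z simp: Z_def)

lemma Ann_Z_subset_Ann_X: "Ann (rank_one Z) \<subseteq> Ann (rank_one X)"
proof
  fix a
  assume "a \<in> Ann (rank_one Z)"
  then have "\<forall>\<xi>\<in>X. a * \<xi> = 0 \<and> star \<xi> * a = 0"
    by (simp add: Ann_Z_iff X_def star_diff star_scaleR right_diff_distrib left_diff_distrib)
  then show "a \<in> Ann (rank_one X)"
    by (simp add: Ann_rank_one_iff vec_X)
qed

text \<open>Killing \<open>X\<close> makes \<open>b * f n\<close> decay like \<open>(1/2)^n\<close>.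
  The weights in \<open>Y\<close> have the same decay, so \<open>b * g n\<close> is constant in
  \<open>n\<close>. Only right multiplication by vectors enters, so that the lemma serves for both
  \<open>a\<close> and \<open>star a\<close>.\<close>

lemma f_eq_0_if_kills_X_Y:
  assumes X: "\<And>n. b * (f n - 2 *\<^sub>R f (Suc n)) = 0"
    and Y: "\<And>n. b * (f n + (1/2)^n *\<^sub>R g n) = 0"
  shows "b * f n = 0"
proof -
  have geom: "b * f n = (1/2)^n *\<^sub>R (b * f 0)" for n
  proof (induction n)
    case (Suc n)
    have "b * f (Suc n) = (1/2) *\<^sub>R (b * f n)"
      using X[of n] by (simp add: right_diff_distrib)
    then show ?case
      using Suc by simp
  qed simp
  have "b * u (2 * n + 1) = - (b * f 0)" for n
  proof -
    have "(1/2::real)^n *\<^sub>R (b * f 0 + b * g n) = 0"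
      using Y[of n] geom[of n] by (simp add: scaleR_add_right distrib_left)
    then show ?thesis
      by (simp add: g_def eq_neg_iff_add_eq_0 add.commute)
  qed
  then have "- (b * f 0) = 0"
    by (rule constant_coefficients_eq_0[rotated]) (auto intro: injI)
  then show ?thesis
    using geom[of n] by simp
qed

lemma Ann_X_Int_Ann_Y: "Ann (rank_one X) \<inter> Ann (rank_one Y) \<subseteq> Ann (rank_one Z)"
proof
  fix a
  assume "a \<in> Ann (rank_one X) \<inter> Ann (rank_one Y)"
  then have
    X: "a * (f n - 2 *\<^sub>R f (Suc n)) = 0" "star (f n - 2 *\<^sub>R f (Suc n)) * a = 0" and
    Y: "a * (f n + (1/2)^n *\<^sub>R g n) = 0" "star (f n + (1/2)^n *\<^sub>R g n) * a = 0" for n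
    by (auto simp: Ann_rank_one_iff vec_X vec_Y) (auto simp: X_def Y_def)
  have X': "star a * (f n - 2 *\<^sub>R f (Suc n)) = 0" for n
    using X(2) by (metis star_mult star_star star_zero)
  have Y': "star a * (f n + (1/2)^n *\<^sub>R g n) = 0" for n
    using Y(2) by (metis star_mult star_star star_zero)
  have 1: "a * f n = 0" for n
    using X(1) Y(1) by (rule f_eq_0_if_kills_X_Y)
  have "star a * f n = 0" for n
    using X' Y' by (rule f_eq_0_if_kills_X_Y)
  then have "star (f n) * a = 0" for n
    by (metis star_mult star_star star_zero)
  with 1 show "a \<in> Ann (rank_one Z)"
    by (simp add: Ann_Z_iff)
qed

lemma Ann_X_noteq_Ann_Z: "Ann (rank_one X) \<noteq> Ann (rank_one Z)"
proof
  assume eq: "Ann (rank_one X) = Ann (rank_one Z)"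
  define h where "h = (\<Sum>n. (1/2)^n *\<^sub>R f n)"
  have "summable (\<lambda>n. norm ((1/2)^n *\<^sub>R f n))"
    by (simp add: f_def norm_u summable_geometric)
  then have sums: "(\<lambda>n. (1/2)^n *\<^sub>R f n) sums h"
    unfolding h_def by (rule summable_sums[OF summable_norm_cancel])
  have fh: "star (f n) * h = (1/2)^n *\<^sub>R e" for n
  proof -
    \<comment> \<open>Multiplication is continuous, so it passes through the series and
      orthonormality leaves one term.\<close>
    have "(\<lambda>m. star (f n) * ((1/2)^m *\<^sub>R f m)) sums (star (f n) * h)"
      using sums by (rule sums_mult)
    moreover have "star (f n) * ((1/2)^m *\<^sub>R f m) = (if m = n then (1/2)^m *\<^sub>R e else 0)" for m
      by auto
    ultimately show ?thesis
      using sums_single[of n "\<lambda>m. (1/2)^m *\<^sub>R e"] sums_unique2 by fastforce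
  qed
  \<comment> \<open>The coefficients of \<open>h\<close> halve at each index, which cancels the
    factor 2 in the vectors of \<open>X\<close>.\<close>
  have "h * star h \<in> Ann (rank_one X)"
    by (rule rank_one_in_Ann[OF vec_X])
       (auto simp: X_def star_diff star_scaleR left_diff_distrib fh)
  then have "h * star h \<in> Ann (rank_one Z)"
    using eq by simp
  then have "star (f 0) * h * star h = 0"
    by (simp add: Ann_Z_iff mult.assoc)
  then have "e * star h = 0"
    by (simp add: fh)
  then have "h * e = 0"
    by (metis star_e star_mult star_star star_zero)
  then have "star (f 0) * h * e = 0"
    by (simp add: mult.assoc)
  then show False
    using fh[of 0] e_idem e_nonzero by simp
qed

lemma Y_Int_Z: "Ann (Ann (rank_one Y)) \<inter> Ann (Ann (rank_one Z)) = {0}"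
proof -
  have "a = 0" if aY: "a \<in> Ann (Ann (rank_one Y))" and aZ: "a \<in> Ann (Ann (rank_one Z))" for a
  proof -
    have "vec (g n)" for n
      by (simp add: g_def vec_u)
    moreover have "star \<xi> * g n = 0" if "\<xi> \<in> Z" for \<xi> n
      using that by (auto simp: Z_def)
    ultimately have g0: "a * g n = 0" "star (g n) * a = 0" for n
      using kills_vec_if_Ann_Ann[OF vec_Z _ _ aZ] by blast+
    \<comment> \<open>Within the span of \<open>f n\<close> and \<open>g n\<close>, this is the
      direction orthogonal to the vector of \<open>Y\<close>; together with \<open>g n\<close> it
      recovers \<open>f n\<close>.\<close>
    define k where "k n = (1/2)^n *\<^sub>R f n - g n" for n
    have "vec (k n)" for n
      using vec_combination[of "2 * n" "2 * n + 1" "(1/2)^n" "-1"] by (simp add: k_def f_def g_def)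
    moreover have "star \<xi> * k n = 0" if "\<xi> \<in> Y" for \<xi> n
      using that by (auto simp: Y_def k_def star_add star_scaleR distrib_right right_diff_distrib)
    ultimately have "a * k n = 0" "star (k n) * a = 0" for n
      using kills_vec_if_Ann_Ann[OF vec_Y _ _ aY] by blast+
    then have "a * f n = 0" "star (f n) * a = 0" for n
      using g0 by (simp_all add: k_def star_diff star_scaleR right_diff_distrib left_diff_distrib)
    then have "a \<in> Ann (rank_one Z)"
      by (simp add: Ann_Z_iff)
    then show ?thesis
      using aZ Ann_Int_Ann_Ann vec_Z by blast
  qed
  moreover have "0 \<in> Ann (Ann (rank_one Y)) \<inter> Ann (Ann (rank_one Z))"
    by (simp add: Ann_def)
  ultimately show ?thesis
    by blast
qed

theorem not_modular: "\<not> modular_lattice (ann_lattice star)"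
proof
  assume "modular_lattice (ann_lattice star)"
  then have "Ann (Ann (rank_one X)) = Ann (Ann (rank_one Z))"
    by (rule modular_ann_lattice_cancel[OF _ rank_one_in_ann_lattice rank_one_in_ann_lattice
          rank_one_in_ann_lattice Ann_antimono[OF Ann_Z_subset_Ann_X] Y_Int_Z])
       (simp add: Ann_X_Int_Ann_Y)
  then show False
    using Ann_X_noteq_Ann_Z by (metis Ann_Ann_Ann)
qed

end

section \<open>Infinite projections\<close>

text \<open>As in the Wold decomposition, \<open>e = p - q\<close> is wandering for the partial
  isometry \<open>v\<close>: the range projection \<open>q\<close> is orthogonal to
  \<open>e\<close>, so \<open>e * v = 0\<close>.\<close>

lemma (in cstar_ring) orthonormal_sequence_if_infinite:
  assumes "infinite_projection star p"
  obtains e u where "orthonormal_sequence star e u"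
proof -
  obtain q v where p: "star p = p" "p * p = p" and q: "star q = q" "q * q = q"
    and qp: "q * p = q" "q \<noteq> p" and v: "star v * v = p" "v * star v = q"
    using assms
    unfolding infinite_projection_def projection_def proper_subprojection_def mvn_equiv_def
    by metis
  have pq: "p * q = q"
    using p q qp by (metis star_mult)
  \<comment> \<open>Expanding with \<open>star v * v = p\<close> makes all terms cancel; the
    C*-identity then gives \<open>v = v * p\<close>.\<close>
  have "star (v - v * p) * (v - v * p) = 0"
    by (simp add: star_diff star_mult p left_diff_distrib right_diff_distrib mult.assoc v)
       (simp add: mult.assoc[symmetric] v p)
  then have vp: "v * p = v"
    by simp
  have qv: "q * v = v"
    using v vp by (metis mult.assoc)
  have pv: "p * v = v"
    using qv pq by (metis mult.assoc)
  define e where "e = p - q"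
  have e: "e * e = e" "star e = e" "e * v = 0" "e \<noteq> 0" "p * e = e"
    using p q qp pq pv qv by (simp_all add: e_def star_diff algebra_simps)
  \<comment> \<open>Iterated left multiplication avoids the power \<open>v^0\<close>, as the algebra
    may lack a unit.\<close>
  define u where "u n = ((*) v ^^ n) e" for n
  have u_simps: "u 0 = e" "u (Suc n) = v * u n" for n
    by (simp_all add: u_def)
  have pu: "p * u n = u n" for n
    by (cases n) (simp_all add: u_simps e pv mult.assoc[symmetric])
  \<comment> \<open>The inner factor \<open>star v * v = p\<close> acts as the identity on each
    \<open>u n\<close>.\<close>
  have u_Suc: "star (u (Suc i)) * u (Suc j) = star (u i) * u j" for i j
    by (metis mult.assoc pu star_mult u_simps(2) v(1))
  have e_u: "e * u (Suc j) = 0" for j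
    by (simp add: u_simps mult.assoc[symmetric] e)
  have u_e_0: "star (u (Suc i)) * e = 0" for i
    using e_u[of i] e(2) by (metis star_mult star_zero)
  have "star (u i) * u j = (if i = j then e else 0)" for i j
  proof (induction i arbitrary: j)
    case 0
    show ?case
      by (cases j) (simp_all add: u_simps(1) e e_u)
  next
    case (Suc i)
    show ?case
      by (cases j) (simp_all add: u_Suc Suc u_simps(1) u_e_0)
  qed
  moreover have "u i * e = u i" for i
    by (induction i) (simp_all add: u_simps e mult.assoc)
  ultimately have "orthonormal_sequence star e u"
    using e(4) by unfold_locales auto
  then show thesis
    by (rule that)
qed

theorem theorem28:
  fixes cmul :: "complex \<Rightarrow> 'a::{real_normed_algebra,banach} \<Rightarrow> 'a"
    and star :: "'a \<Rightarrow> 'a"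
  assumes "cstar_algebra cmul star"
    and "simple_cstar cmul"
    and "type_II1 star"
  shows "\<forall>p. projection star p \<longrightarrow> finite_projection star p"
proof -
  have scaleR: "r *\<^sub>R x = cmul (complex_of_real r) x"
    and star_cmul: "star (cmul c x) = cmul (cnj c) (star x)" for r c x
    using assms(1) unfolding cstar_algebra_def by simp_all
  interpret cstar_ring star
  proof
    \<comment> \<open>Real scalars are fixed by \<open>cnj\<close>.\<close>
    show "star (r *\<^sub>R x) = r *\<^sub>R star x" for r x
      by (simp add: scaleR star_cmul)
    show "star (star x) = x" and "star (x + y) = star x + star y"
      and "star (x * y) = star y * star x" and "norm (star x * x) = (norm x)\<^sup>2" for x y
      using assms(1) unfolding cstar_algebra_def by simp_all
  qed
  have "\<not> infinite_projection star p" for p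
    using assms(3) orthonormal_sequence_if_infinite orthonormal_sequence.not_modular
    unfolding type_II1_def by metis
  then show ?thesis
    by (simp add: finite_projection_def)
qed

end
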